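(* Let $\mathcal{H}$ be a complex Hilbert space, let $A\in\mathbb{B}(\mathcal{H})$ be a positive operator, and let $T, S\in\mathbb{B}_{A^{1/2}}(\mathcal{H})$. Then the following conditions are equivalent: (i) $A^{1/2}T = A^{1/2}S$. (ii) $W_{A}(TR) = W_{A}(SR)$ for all $R\in\mathbb{B}_{A^{1/2}}(\mathcal{H})$. (iii) $W_{A}\big(Tx \otimes_{A} y\big) = W_{A}\big(Sx \otimes_{A} y\big)$ for all $x, y \in\mathcal{H}\setminus\{0\}$.
   Context: $\mathbb{B}(\mathcal{H})$ denotes the bounded linear operators on the complex Hilbert space $(\mathcal{H},\langle\cdot,\cdot\rangle)$. $A\in\mathbb{B}(\mathcal{H})$ is positive, meaning $\langle Ax,x\rangle\ge 0$ for all $x\in\mathcal{H}$ ($A$ need not be injective or have closed range), and $A^{1/2}$ is its positive square root. Put $\langle x,y\rangle_A := \langle Ax,y\rangle$ and $\|x\|_A := \langle x,x\rangle_A^{1/2}$. $\mathbb{B}_{A^{1/2}}(\mathcal{H})$ is the set of all $T\in\mathbb{B}(\mathcal{H})$ admitting an $A^{1/2}$-adjoint, i.e. for which there is $R\in\mathbb{B}(\mathcal{H})$ with $A^{1/2}R=T^*A^{1/2}$; equivalently, those $T\in\mathbb{B}(\mathcal{H})$ for which there is $c>0$ with $\|Tx\|_A\le c\|x\|_A$ for all $x\in\mathcal{H}$. The $A$-numerical range of $T\in\mathbb{B}(\mathcal{H})$ is the set $W_A(T) := \{\langle Tx,x\rangle_A : x\in\mathcal{H},\ \|x\|_A=1\}\subseteq\mathbb{C}$.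 For $x,y\in\mathcal{H}$, the $A$-rank one operator $x\otimes_A y\in\mathbb{B}(\mathcal{H})$ is defined by $(x\otimes_A y)z := \langle z,y\rangle_A\, x$ for $z\in\mathcal{H}$; $Tx\otimes_A y$ means $(Tx)\otimes_A y$. *)

theory Defs
  imports "HOL-Analysis.Analysis"
begin

class complex_vector = real_vector +
  fixes scaleC :: "complex \<Rightarrow> 'a \<Rightarrow> 'a" (infixr "*\<^sub>C" 75)
  assumes scaleC_add_right: "c *\<^sub>C (x + y) = c *\<^sub>C x + c *\<^sub>C y"
    and scaleC_add_left: "(c + d) *\<^sub>C x = c *\<^sub>C x + d *\<^sub>C x"
    and scaleC_scaleC: "c *\<^sub>C d *\<^sub>C x = (c * d) *\<^sub>C x"
    and scaleC_of_real: "of_real r *\<^sub>C x = r *\<^sub>R x"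

text \<open>The inner product is linear in its first and antilinear in its second argument.
  Positive definiteness follows from \<open>cinner_self\<close>.\<close>

class complex_inner = complex_vector + real_normed_vector +
  fixes cinner :: "'a \<Rightarrow> 'a \<Rightarrow> complex"
  assumes cinner_add_left: "cinner (x + y) z = cinner x z + cinner y z"
    and cinner_scaleC_left: "cinner (c *\<^sub>C x) y = c * cinner x y"
    and cinner_commute: "cinner x y = cnj (cinner y x)"
    and cinner_self: "cinner x x = of_real ((norm x)\<^sup>2)"

class chilbert_space = complex_inner + banach

instantiation complex :: chilbert_space
begin

definition scaleC_complex :: "complex \<Rightarrow> complex \<Rightarrow> complex"
  where "scaleC_complex c x = c * x"

definition cinner_complex :: "complex \<Rightarrow> complex \<Rightarrow> complex"
  where "cinner_complex x y = x * cnj y"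

instance
proof
  fix x :: complex
  show "cinner x x = of_real ((norm x)\<^sup>2)"
    by (simp only: cinner_complex_def complex_norm_square)
qed (auto simp: scaleC_complex_def cinner_complex_def algebra_simps scaleR_conv_of_real)

end

definition bounded_clinear :: "('a::complex_inner \<Rightarrow> 'b::complex_inner) \<Rightarrow> bool"
  where "bounded_clinear T \<longleftrightarrow> bounded_linear T \<and> (\<forall>c x. T (c *\<^sub>C x) = c *\<^sub>C T x)"

definition positive_op :: "('a::chilbert_space \<Rightarrow> 'a) \<Rightarrow> bool"
  where "positive_op A \<longleftrightarrow> bounded_clinear A \<and> (\<forall>x. cinner (A x) x \<in> \<real>\<^sub>\<ge>\<^sub>0)"

definition sqrt_op :: "('a::chilbert_space \<Rightarrow> 'a) \<Rightarrow> 'a \<Rightarrow> 'a"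
  where "sqrt_op A = (THE B. positive_op B \<and> B \<circ> B = A)"

definition cadjoint :: "('a::chilbert_space \<Rightarrow> 'b::chilbert_space) \<Rightarrow> 'b \<Rightarrow> 'a"
  where "cadjoint T = (THE S. \<forall>x y. cinner (T x) y = cinner x (S y))"

definition A_inner :: "('a::chilbert_space \<Rightarrow> 'a) \<Rightarrow> 'a \<Rightarrow> 'a \<Rightarrow> complex"
  where "A_inner A x y = cinner (A x) y"

text \<open>For positive \<open>A\<close> the number \<open>A_inner A x x\<close> is real and nonnegative, so taking the
  real part only changes its type.\<close>

definition A_norm :: "('a::chilbert_space \<Rightarrow> 'a) \<Rightarrow> 'a \<Rightarrow> real"
  where "A_norm A x = sqrt (Re (A_inner A x x))"

definition sqrt_adjointable :: "('a::chilbert_space \<Rightarrow> 'a) \<Rightarrow> ('a \<Rightarrow> 'a) set"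
  where "sqrt_adjointable A =
    {T. bounded_clinear T \<and>
        (\<exists>R. bounded_clinear R \<and> sqrt_op A \<circ> R = cadjoint T \<circ> sqrt_op A)}"

definition A_numerical_range :: "('a::chilbert_space \<Rightarrow> 'a) \<Rightarrow> ('a \<Rightarrow> 'a) \<Rightarrow> complex set"
  where "A_numerical_range A T = {A_inner A (T x) x | x. A_norm A x = 1}"

definition A_rank_one :: "('a::chilbert_space \<Rightarrow> 'a) \<Rightarrow> 'a \<Rightarrow> 'a \<Rightarrow> 'a \<Rightarrow> 'a"
  where "A_rank_one A x y z = A_inner A z y *\<^sub>C x"

end

theory Submission
  imports Defs
begin

text \<open>
  Write \<open>C\<close> for the positive square root of \<open>A\<close>. Since \<open>A = C \<circ> C\<close> and \<open>C\<close> is symmetric,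
  the form \<open>A_inner A x y\<close> is \<open>cinner (C x) (C y)\<close>; everything about \<open>A\<close>-numerical ranges is a
  statement about ordinary inner products of vectors in the range of \<open>C\<close>.

  (i) implies (ii) because \<open>A_inner A (T w) z = cinner (C (T w)) (C z)\<close> depends on \<open>T\<close> only through
  \<open>C \<circ> T\<close>. (ii) implies (iii) because \<open>(T x) \<otimes> y = T \<circ> (x \<otimes> y)\<close>, and \<open>x \<otimes> y\<close> has the explicit
  square root adjoint \<open>w \<mapsto> cinner (C w) x *\<^sub>C C y\<close>.

  For (iii) implies (i), fix \<open>x\<close> and put \<open>a = C (T x)\<close>, \<open>b = C (S x)\<close>. The numerical range of
  \<open>(T x) \<otimes> y\<close> consists of the numbers \<open>cinner z (C y) * cinner a z\<close> with \<open>z\<close> a unit vector in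
  the range of \<open>C\<close>. If \<open>b \<noteq> 0\<close>, the choice \<open>y = S x\<close> turns the right-hand range into the set of
  all \<open>\<bar>cinner z b\<bar>\<^sup>2\<close>, which is contained in \<open>[0, \<parallel>b\<parallel>\<^sup>2]\<close> and contains \<open>\<parallel>b\<parallel>\<^sup>2\<close>. Reality of
  the left-hand range makes \<open>a\<close> a multiple of \<open>b\<close>, and comparing the largest elements makes the
  factor \<open>1\<close> (lemma \<open>eq_if_rank_one_ranges_eq\<close>). If \<open>a \<noteq> 0\<close>, the roles of \<open>T\<close> and \<open>S\<close> can be
  exchanged.

  All this rests on the existence and uniqueness of the positive square root. After rescaling, \<open>A\<close>
  is \<open>1 - B\<close> with \<open>\<parallel>B\<parallel> \<le> 1\<close>, and \<open>1 - Y\<close> is a root of \<open>1 - B\<close> exactly if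
  \<open>Y = (B + Y\<^sup>2) / 2\<close>. The iteration of this equation from \<open>0\<close> is dominated, step by step, by the
  same iteration for the number \<open>1\<close>, which increases and is bounded; so it converges in
  operator norm. Its limit commutes with every operator that commutes with \<open>A\<close>, and this property
  gives uniqueness.
\<close>

section \<open>Complex inner products\<close>

lemma cinner_add_right: "cinner x (y + z) = cinner x y + cinner (x::'a::complex_inner) z"
  by (metis cinner_add_left cinner_commute complex_cnj_add)

lemma cinner_scaleC_right: "cinner x (c *\<^sub>C y) = cnj c * cinner (x::'a::complex_inner) y"
  by (metis cinner_scaleC_left cinner_commute complex_cnj_mult)

lemma cinner_scaleR_left: "cinner (r *\<^sub>R x) y = of_real r * cinner (x::'a::complex_inner) y"
  by (metis cinner_scaleC_left scaleC_of_real)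

lemma cinner_scaleR_right: "cinner x (r *\<^sub>R y) = of_real r * cinner (x::'a::complex_inner) y"
  by (metis cinner_scaleC_right scaleC_of_real complex_cnj_complex_of_real)

lemma cinner_zero_left [simp]: "cinner 0 (x::'a::complex_inner) = 0"
  using cinner_scaleR_left[of 0 x x] by simp

lemma cinner_zero_right [simp]: "cinner (x::'a::complex_inner) 0 = 0"
  using cinner_scaleR_right[of x 0 x] by simp

lemma cinner_diff_left: "cinner (x - y) z = cinner x z - cinner (y::'a::complex_inner) z"
  using cinner_add_left[of "x - y" y z] by simp

lemma cinner_diff_right: "cinner x (y - z) = cinner x y - cinner (x::'a::complex_inner) z"
  using cinner_add_right[of x "y - z" z] by simp

lemmas cinner_simps = cinner_add_left cinner_add_right cinner_diff_left cinner_diff_right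
  cinner_scaleC_left cinner_scaleC_right cinner_scaleR_left cinner_scaleR_right

lemma scaleC_scaleR_commute: "c *\<^sub>C r *\<^sub>R x = r *\<^sub>R c *\<^sub>C (x::'a::complex_vector)"
  by (metis scaleC_of_real scaleC_scaleC mult.commute)

lemma Re_cinner_self: "Re (cinner x x) = (norm (x::'a::complex_inner))\<^sup>2"
  by (simp add: cinner_self)

lemma norm_scaleC: "norm (c *\<^sub>C x) = cmod c * norm (x::'a::complex_inner)"
proof -
  have "complex_of_real ((norm (c *\<^sub>C x))\<^sup>2) = of_real ((cmod c * norm x)\<^sup>2)"
    unfolding cinner_self[symmetric] cinner_simps
    by (simp add: cinner_self power_mult_distrib complex_norm_square mult_ac del: of_real_power)
  then have "(norm (c *\<^sub>C x))\<^sup>2 = (cmod c * norm x)\<^sup>2"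
    using of_real_eq_iff by blast
  then show ?thesis by simp
qed

lemma bounded_linear_scaleC: "bounded_linear (\<lambda>x::'a::complex_inner. c *\<^sub>C x)"
proof (rule bounded_linear_intro)
  show "norm (c *\<^sub>C x) \<le> norm x * cmod c" for x :: 'a
    by (simp add: norm_scaleC)
qed (simp_all add: scaleC_add_right scaleC_scaleR_commute)

lemma norm_add_square:
  "(norm (x + y))\<^sup>2 = (norm x)\<^sup>2 + 2 * Re (cinner x y) + (norm (y::'a::complex_inner))\<^sup>2"
proof -
  have "Re (cinner y x) = Re (cinner x y)"
    by (subst cinner_commute) simp
  then show ?thesis
    by (simp add: Re_cinner_self[symmetric] cinner_simps)
qed

text \<open>The class provides the triangle inequality for the norm, and squaring it gives the
  real part of the Cauchy-Schwarz inequality.\<close>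

lemma Re_cinner_le: "Re (cinner x y) \<le> norm x * norm (y::'a::complex_inner)"
proof -
  have "(norm (x + y))\<^sup>2 \<le> (norm x + norm y)\<^sup>2"
    by (rule power_mono) (auto simp: norm_triangle_ineq)
  then show ?thesis
    by (simp add: norm_add_square power2_sum)
qed

lemma norm_cinner_le: "cmod (cinner x y) \<le> norm x * norm (y::'a::complex_inner)"
proof (cases "cinner x y = 0")
  case False
  \<comment> \<open>the phase that rotates the inner product onto the positive real axis\<close>
  define c where "c = cnj (sgn (cinner x y))"
  have "cmod c = 1"
    using False by (simp add: c_def norm_sgn)
  moreover have "cinner (c *\<^sub>C x) y = of_real (cmod (cinner x y))"
    using False by (simp add: c_def cinner_simps sgn_eq field_simps complex_norm_square[symmetric]
        power2_eq_square)
  ultimately show ?thesis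
    using Re_cinner_le[of "c *\<^sub>C x" y] by (simp add: norm_scaleC)
qed simp

lemma bounded_bilinear_cinner:
  "bounded_bilinear (cinner :: 'a::complex_inner \<Rightarrow> 'a \<Rightarrow> complex)"
proof
  show "\<exists>K. \<forall>a b::'a. cmod (cinner a b) \<le> norm a * norm b * K"
    by (rule exI[of _ 1]) (simp add: norm_cinner_le)
qed (simp_all add: cinner_simps scaleR_conv_of_real)

lemma cinner_eqI:
  fixes x y :: "'a::complex_inner"
  assumes "\<And>z. cinner z x = cinner z y"
  shows "x = y"
proof -
  have "cinner (x - y) (x - y) = 0"
    using assms by (simp add: cinner_diff_right)
  then show ?thesis
    by (simp add: cinner_self)
qed

section \<open>Positive operators\<close>

lemma bounded_clinearD:
  assumes "bounded_clinear T"
  shows "bounded_linear T" "T (c *\<^sub>C x) = c *\<^sub>C T x" "T (x + y) = T x + T y"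
    "T (x - y) = T x - T y" "T (r *\<^sub>R x) = r *\<^sub>R T x" "T 0 = 0"
  using assms unfolding bounded_clinear_def
  by (auto simp: linear_simps)

lemma positive_op_bounded_clinear: "positive_op A \<Longrightarrow> bounded_clinear A"
  by (simp add: positive_op_def)

lemma positive_op_real:
  assumes "positive_op A"
  shows "Im (cinner (A x) x) = 0" "0 \<le> Re (cinner (A x) x)"
  using assms by (auto simp: positive_op_def complex_nonneg_Reals_iff)

text \<open>Polarization over the complex numbers: reality of the quadratic form at \<open>x + y\<close> and at
  \<open>x + i y\<close> makes the sesquilinear form Hermitian.\<close>

lemma positive_op_symmetric:
  assumes "positive_op A"
  shows "cinner (A x) y = cinner x (A y)"
proof -
  note lin = bounded_clinearD[OF positive_op_bounded_clinear[OF assms]]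
  have "Im (cinner (A x) y + cinner (A y) x) = 0"
    using positive_op_real(1)[OF assms, of "x + y"] positive_op_real(1)[OF assms]
    by (simp add: lin cinner_simps)
  moreover have "Re (cinner (A y) x - cinner (A x) y) = 0"
    using positive_op_real(1)[OF assms, of "x + \<i> *\<^sub>C y"] positive_op_real(1)[OF assms]
    by (simp add: lin cinner_simps)
  ultimately have "cinner (A x) y = cnj (cinner (A y) x)"
    by (simp add: complex_eq_iff)
  then show ?thesis
    by (simp add: cinner_commute[of x])
qed

text \<open>The operator inequality \<open>A\<^sup>2 \<le> K A\<close> for \<open>0 \<le> A \<le> K\<close>, obtained from positivity of the form
  at the single vector \<open>x - A x / K\<close>.\<close>

lemma positive_op_norm_square_le:
  assumes A: "positive_op A" and K: "K > 0" "\<And>x. norm (A x) \<le> K * norm x"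
  shows "(norm (A x))\<^sup>2 \<le> K * Re (cinner (A x) x)"
proof -
  note lin = bounded_clinearD[OF positive_op_bounded_clinear[OF A]]
  define t where "t = 1 / K"
  have Axx: "cinner (A (A x)) x = cinner (A x) (A x)"
    by (rule positive_op_symmetric[OF A])
  have "0 \<le> Re (cinner (A (x - t *\<^sub>R A x)) (x - t *\<^sub>R A x))"
    by (rule positive_op_real[OF A])
  also have "\<dots> = Re (cinner (A x) x) - 2 * t * (norm (A x))\<^sup>2
      + t\<^sup>2 * Re (cinner (A (A x)) (A x))"
    by (simp add: lin cinner_simps Axx Re_cinner_self power2_eq_square algebra_simps)
  also have "\<dots> \<le> Re (cinner (A x) x) - 2 * t * (norm (A x))\<^sup>2 + t\<^sup>2 * (K * (norm (A x))\<^sup>2)"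
  proof -
    have "Re (cinner (A (A x)) (A x)) \<le> norm (A (A x)) * norm (A x)"
      by (rule Re_cinner_le)
    also have "\<dots> \<le> (K * norm (A x)) * norm (A x)"
      by (intro mult_right_mono K) auto
    finally have "Re (cinner (A (A x)) (A x)) \<le> K * (norm (A x))\<^sup>2"
      by (simp add: power2_eq_square mult.assoc)
    from mult_left_mono[OF this zero_le_power2[of t]] show ?thesis
      by simp
  qed
  also have "\<dots> = Re (cinner (A x) x) - (norm (A x))\<^sup>2 / K"
    using K(1) by (simp add: t_def power2_eq_square field_simps)
  finally show ?thesis
    using K(1) by (simp add: field_simps)
qed

lemma positive_op_eq_0:
  assumes A: "positive_op A" and "Re (cinner (A x) x) = 0"
  shows "A x = 0"
proof -
  obtain K where "K > 0" "\<And>x. norm (A x) \<le> norm x * K"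
    using bounded_linear.pos_bounded[OF bounded_clinearD(1)[OF positive_op_bounded_clinear[OF A]]]
    by blast
  then show ?thesis
    using positive_op_norm_square_le[OF A, of K x] assms(2) by (simp add: mult.commute)
qed

section \<open>The square root of one minus a contraction\<close>

primrec root_iter :: "('a::real_normed_vector \<Rightarrow>\<^sub>L 'a) \<Rightarrow> nat \<Rightarrow> ('a \<Rightarrow>\<^sub>L 'a)" where
  "root_iter B 0 = 0"
| "root_iter B (Suc n) = (1/2) *\<^sub>R (B + (root_iter B n o\<^sub>L root_iter B n))"

text \<open>The same iteration with the number \<open>1\<close> in place of \<open>B\<close>.\<close>

primrec root_majorant :: "nat \<Rightarrow> real" where
  "root_majorant 0 = 0"
| "root_majorant (Suc n) = (1 + (root_majorant n)\<^sup>2) / 2"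

lemma root_majorant_bounds: "0 \<le> root_majorant n \<and> root_majorant n \<le> 1"
  by (induction n) (auto simp: power_le_one)

lemma convergent_root_majorant: "convergent root_majorant"
proof -
  have "root_majorant n \<le> root_majorant (Suc n)" for n
    using zero_le_power2[of "1 - root_majorant n"] by (simp add: power2_diff)
  then have "incseq root_majorant"
    by (rule incseq_SucI)
  then obtain L where "root_majorant \<longlonglongrightarrow> L"
    using incseq_convergent[of root_majorant 1] root_majorant_bounds by blast
  then show ?thesis
    by (auto simp: convergent_def)
qed

lemma norm_root_iter_le:
  assumes "norm B \<le> 1"
  shows "norm (root_iter B n) \<le> root_majorant n"
proof (induction n)
  case (Suc n)
  have "norm (root_iter B n o\<^sub>L root_iter B n) \<le> norm (root_iter B n) * norm (root_iter B n)"
    by (rule norm_blinfun_compose)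
  also have "\<dots> \<le> (root_majorant n)\<^sup>2"
    unfolding power2_eq_square by (intro mult_mono Suc) (auto simp: root_majorant_bounds)
  finally have "norm (B + (root_iter B n o\<^sub>L root_iter B n)) \<le> 1 + (root_majorant n)\<^sup>2"
    using assms by (intro norm_triangle_le) simp
  then show ?case
    by simp
qed simp

text \<open>With \<open>D\<close> the difference and \<open>P\<close> the sum of two consecutive iterates, the next difference is
  \<open>(D P + P D) / 4\<close>. This symmetrized form of the difference of two squares holds without
  commutativity.\<close>

lemma norm_root_iter_diff_le:
  assumes "norm B \<le> 1"
  shows "norm (root_iter B (Suc n) - root_iter B n) \<le> root_majorant (Suc n) - root_majorant n"
proof (induction n)
  case 0
  then show ?case using assms by simp
next
  case (Suc n)
  let ?Y = "root_iter B (Suc n)" and ?Z = "root_iter B n"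
  let ?y = "root_majorant (Suc n)" and ?z = "root_majorant n"
  define D P where "D = ?Y - ?Z" and "P = ?Y + ?Z"
  have D: "norm D \<le> ?y - ?z"
    unfolding D_def by (rule Suc)
  have P: "norm P \<le> ?y + ?z"
    unfolding P_def by (intro norm_triangle_mono norm_root_iter_le assms)
  have "root_iter B (Suc (Suc n)) - ?Y = (1/4) *\<^sub>R ((D o\<^sub>L P) + (P o\<^sub>L D))"
  proof -
    have "(D o\<^sub>L P) + (P o\<^sub>L D) = 2 *\<^sub>R ((?Y o\<^sub>L ?Y) - (?Z o\<^sub>L ?Z))"
      unfolding D_def P_def
      by (rule blinfun_eqI) (simp add: blinfun.bilinear_simps scaleR_2 del: root_iter.simps)
    moreover have "root_iter B (Suc (Suc n)) - ?Y = (1/2) *\<^sub>R ((?Y o\<^sub>L ?Y) - (?Z o\<^sub>L ?Z))"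
      unfolding root_iter.simps(2)[of B "Suc n"]
      by (subst (3) root_iter.simps(2)) (simp add: algebra_simps del: root_iter.simps)
    ultimately show ?thesis
      by simp
  qed
  also have "norm \<dots> \<le> (1/4) * (norm D * norm P + norm P * norm D)"
  proof -
    have "norm ((D o\<^sub>L P) + (P o\<^sub>L D)) \<le> norm D * norm P + norm P * norm D"
      by (intro norm_triangle_mono norm_blinfun_compose)
    then show ?thesis
      by simp
  qed
  also have "\<dots> = (norm D * norm P) / 2"
    by simp
  also have "\<dots> \<le> ((?y - ?z) * (?y + ?z)) / 2"
    using order_trans[OF norm_ge_zero D]
    by (intro divide_right_mono mult_mono D P) auto
  also have "\<dots> = root_majorant (Suc (Suc n)) - ?y"
  proof -
    have "root_majorant (Suc (Suc n)) - ?y = (?y\<^sup>2 - ?z\<^sup>2) / 2"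
      unfolding root_majorant.simps(2)[of "Suc n"]
      by (subst (2) root_majorant.simps(2)) (simp add: field_simps del: root_majorant.simps)
    moreover have "(?y - ?z) * (?y + ?z) = ?y\<^sup>2 - ?z\<^sup>2"
      by (simp add: power2_eq_square algebra_simps del: root_majorant.simps)
    ultimately show ?thesis
      by (simp del: root_majorant.simps)
  qed
  finally show ?case .
qed

lemma convergent_root_iter:
  fixes B :: "'a::banach \<Rightarrow>\<^sub>L 'a"
  assumes "norm B \<le> 1"
  shows "convergent (root_iter B)"
proof -
  let ?d = "\<lambda>n. root_iter B (Suc n) - root_iter B n"
  obtain L where "root_majorant \<longlonglongrightarrow> L"
    using convergent_root_majorant by (auto simp: convergent_def)
  then have "summable (\<lambda>n. root_majorant (Suc n) - root_majorant n)"
    by (rule telescope_summable)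
  then have "summable ?d"
    by (rule summable_comparison_test') (rule norm_root_iter_diff_le[OF assms])
  then have "convergent (\<lambda>n. \<Sum>i<n. ?d i)"
    by (simp add: summable_iff_convergent)
  moreover have "(\<Sum>i<n. ?d i) = root_iter B n" for n
    by (subst sum_lessThan_telescope) simp
  ultimately show ?thesis
    by simp
qed

lemma root_iter_commute:
  assumes "C o\<^sub>L B = B o\<^sub>L C"
  shows "C o\<^sub>L root_iter B n = root_iter B n o\<^sub>L C"
proof (induction n)
  case (Suc n)
  have CB: "C (B x) = B (C x)" for x
    using assms by (metis blinfun_apply_blinfun_compose)
  have "C (root_iter B n x) = root_iter B n (C x)" for x
    using Suc by (metis blinfun_apply_blinfun_compose)
  then show ?case
    by (intro blinfun_eqI) (simp add: blinfun.bilinear_simps CB)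
qed simp

lemma root_iter_symmetric:
  fixes B :: "'a::complex_inner \<Rightarrow>\<^sub>L 'a"
  assumes "\<And>x y. cinner (B x) y = cinner x (B y)"
  shows "cinner (root_iter B n x) y = cinner x (root_iter B n y)"
  by (induction n arbitrary: x y) (simp_all add: blinfun.bilinear_simps cinner_simps assms)

lemma contraction_root:
  fixes B :: "'a::chilbert_space \<Rightarrow>\<^sub>L 'a"
  assumes "norm B \<le> 1" and sym: "\<And>x y. cinner (B x) y = cinner x (B y)"
  shows "\<exists>Y :: 'a \<Rightarrow>\<^sub>L 'a. norm Y \<le> 1 \<and> 2 *\<^sub>R Y = B + (Y o\<^sub>L Y) \<and>
    (\<forall>x y. cinner (Y x) y = cinner x (Y y)) \<and>
    (\<forall>C. C o\<^sub>L B = B o\<^sub>L C \<longrightarrow> C o\<^sub>L Y = Y o\<^sub>L C)"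
proof -
  obtain Y where Y: "root_iter B \<longlonglongrightarrow> Y"
    using convergent_root_iter[OF assms(1)] by (auto simp: convergent_def)
  note comp_tendsto = bounded_bilinear.tendsto[OF bounded_bilinear_blinfun_compose]
  note cinner_tendsto = bounded_bilinear.tendsto[OF bounded_bilinear_cinner]
  show ?thesis
  proof (intro exI[of _ Y] conjI allI impI)
    have "norm (root_iter B n) \<le> 1" for n
      using norm_root_iter_le[OF assms(1), of n] root_majorant_bounds[of n] by linarith
    then show "norm Y \<le> 1"
      using Lim_bounded[OF tendsto_norm[OF Y]] by blast
  next
    have "(\<lambda>n. 2 *\<^sub>R root_iter B (Suc n)) \<longlonglongrightarrow> 2 *\<^sub>R Y"
      using LIMSEQ_Suc[OF Y] by (intro tendsto_intros)
    moreover have "(\<lambda>n. 2 *\<^sub>R root_iter B (Suc n)) \<longlonglongrightarrow> B + (Y o\<^sub>L Y)"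
      using tendsto_add[OF tendsto_const comp_tendsto[OF Y Y]] by simp
    ultimately show "2 *\<^sub>R Y = B + (Y o\<^sub>L Y)"
      by (rule LIMSEQ_unique)
  next
    fix x y
    have Yx: "(\<lambda>n. root_iter B n x) \<longlonglongrightarrow> Y x" for x
      by (intro blinfun.tendsto Y tendsto_const)
    have "(\<lambda>n. cinner (root_iter B n x) y) \<longlonglongrightarrow> cinner (Y x) y"
      by (rule cinner_tendsto[OF Yx tendsto_const])
    moreover have "(\<lambda>n. cinner (root_iter B n x) y) \<longlonglongrightarrow> cinner x (Y y)"
      unfolding root_iter_symmetric[of B, OF sym] by (rule cinner_tendsto[OF tendsto_const Yx])
    ultimately show "cinner (Y x) y = cinner x (Y y)"
      by (rule LIMSEQ_unique)
  next
    fix C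
    assume C: "C o\<^sub>L B = B o\<^sub>L C"
    have "(\<lambda>n. C o\<^sub>L root_iter B n) \<longlonglongrightarrow> (C o\<^sub>L Y)"
      by (rule comp_tendsto[OF tendsto_const Y])
    moreover have "(\<lambda>n. C o\<^sub>L root_iter B n) \<longlonglongrightarrow> (Y o\<^sub>L C)"
      unfolding root_iter_commute[OF C] by (rule comp_tendsto[OF Y tendsto_const])
    ultimately show "C o\<^sub>L Y = Y o\<^sub>L C"
      by (rule LIMSEQ_unique)
  qed
qed

section \<open>The positive square root\<close>

text \<open>The root commutes with all bounded real-linear maps that commute with \<open>A\<close>. Multiplication by
  a complex scalar is such a map, which is how complex linearity of the root is obtained.\<close>

lemma positive_root_exists:
  assumes A: "positive_op A"
  obtains C where "positive_op C" "C \<circ> C = A"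
    "\<And>D x. bounded_linear D \<Longrightarrow> (\<And>x. D (A x) = A (D x)) \<Longrightarrow> D (C x) = C (D x)"
proof -
  note lin = bounded_clinearD[OF positive_op_bounded_clinear[OF A]]
  obtain K where K: "K > 0" "\<And>x. norm (A x) \<le> norm x * K"
    using bounded_linear.pos_bounded[OF lin(1)] by blast
  define B where "B = id_blinfun - (1 / K) *\<^sub>R Blinfun A"
  have B: "B x = x - (1 / K) *\<^sub>R A x" for x
    by (simp add: B_def blinfun.bilinear_simps bounded_linear_Blinfun_apply lin)
  \<comment> \<open>\<open>\<parallel>x - A x / K\<parallel>\<^sup>2 = \<parallel>x\<parallel>\<^sup>2 - 2 \<langle>A x, x\<rangle> / K + \<parallel>A x\<parallel>\<^sup>2 / K\<^sup>2\<close>, where the last term is at most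
    \<open>\<langle>A x, x\<rangle> / K\<close>\<close>
  have "norm (B x) \<le> 1 * norm x" for x
  proof -
    have "(norm (A x))\<^sup>2 \<le> K * Re (cinner (A x) x)"
      using K by (intro positive_op_norm_square_le[OF A]) (auto simp: mult.commute)
    moreover have "0 \<le> K * Re (cinner (A x) x)"
      using K(1) positive_op_real[OF A, of x] by simp
    moreover have "(norm (B x))\<^sup>2
        = (norm x)\<^sup>2 - (2 * (K * Re (cinner (A x) x)) - (norm (A x))\<^sup>2) / K\<^sup>2"
    proof -
      have "cinner (A x) x = cinner x (A x)"
        by (rule positive_op_symmetric[OF A])
      then have "Re (cinner (B x) (B x))
          = Re (cinner x x) - 2 * Re (cinner (A x) x) / K + Re (cinner (A x) (A x)) / K\<^sup>2"
        unfolding B using K(1) by (simp add: cinner_simps power2_eq_square field_simps)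
      then show ?thesis
        using K(1) by (simp add: Re_cinner_self power2_eq_square field_simps)
    qed
    ultimately have "(norm (B x))\<^sup>2 \<le> (norm x)\<^sup>2"
      by (simp add: divide_nonneg_nonneg)
    then have "norm (B x) \<le> norm x"
      by (rule power2_le_imp_le) simp
    then show ?thesis
      by simp
  qed
  then have "norm B \<le> 1"
    by (intro norm_blinfun_bound) auto
  moreover have "cinner (B x) y = cinner x (B y)" for x y
    by (simp add: B cinner_simps positive_op_symmetric[OF A])
  ultimately obtain Y :: "'a \<Rightarrow>\<^sub>L 'a" where Y: "norm Y \<le> 1" "2 *\<^sub>R Y = B + (Y o\<^sub>L Y)"
    and Ysym: "\<And>x y. cinner (Y x) y = cinner x (Y y)"
    and Ycomm: "\<And>C. C o\<^sub>L B = B o\<^sub>L C \<Longrightarrow> C o\<^sub>L Y = Y o\<^sub>L C"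
    using contraction_root[of B] by blast
  define C where "C x = sqrt K *\<^sub>R (x - Y x)" for x
  have comm: "D (C x) = C (D x)" if D: "bounded_linear D" "\<And>x. D (A x) = A (D x)" for D x
  proof -
    have "Blinfun D o\<^sub>L B = B o\<^sub>L Blinfun D"
      by (rule blinfun_eqI)
        (simp add: B bounded_linear_Blinfun_apply D linear_simps[OF D(1)])
    from Ycomm[OF this] have "D (Y x) = Y (D x)"
      by (metis blinfun_apply_blinfun_compose bounded_linear_Blinfun_apply D(1))
    then show ?thesis
      by (simp add: C_def linear_simps[OF D(1)])
  qed
  have "positive_op C"
    unfolding positive_op_def bounded_clinear_def
  proof (intro conjI allI)
    have "bounded_linear (\<lambda>x. sqrt K *\<^sub>R (x - Y x))"
      by (intro bounded_linear_intros)
    then show "bounded_linear C"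
      by (simp add: C_def[abs_def])
    show "C (c *\<^sub>C x) = c *\<^sub>C C x" for c x
      by (rule comm[symmetric]) (simp_all add: bounded_linear_scaleC lin)
    show "cinner (C x) x \<in> \<real>\<^sub>\<ge>\<^sub>0" for x
    proof -
      have "Im (cinner (Y x) x) = 0"
        using Ysym[of x x] cinner_commute[of x "Y x"]
        by (metis complex_cnj_cancel_iff Reals_cnj_iff complex_is_Real_iff)
      moreover have "Re (cinner (Y x) x) \<le> (norm x)\<^sup>2"
      proof -
        have "norm (Y x) \<le> 1 * norm x"
          using norm_blinfun[of Y x] Y(1) by (meson mult_right_mono norm_ge_zero order_trans)
        then have "norm (Y x) * norm x \<le> (norm x)\<^sup>2"
          by (simp add: power2_eq_square mult_right_mono)
        then show ?thesis
          using Re_cinner_le[of "Y x" x] by simp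
      qed
      ultimately show ?thesis
        using K(1) by (simp add: complex_nonneg_Reals_iff C_def cinner_simps cinner_self)
    qed
  qed
  moreover have "C \<circ> C = A"
  proof
    fix x
    have "2 *\<^sub>R Y x = B x + Y (Y x)"
      using arg_cong[OF Y(2), of "\<lambda>Z. blinfun_apply Z x"] by (simp add: blinfun.bilinear_simps)
    then have "(1 / K) *\<^sub>R A x = x - 2 *\<^sub>R Y x + Y (Y x)"
      by (simp add: B algebra_simps)
    then have "x - Y x - Y (x - Y x) = (1 / K) *\<^sub>R A x"
      by (simp add: blinfun.bilinear_simps scaleR_2)
    moreover have "C (C x) = (sqrt K * sqrt K) *\<^sub>R (x - Y x - Y (x - Y x))"
      by (simp add: C_def blinfun.bilinear_simps scaleR_diff_right)
    ultimately show "(C \<circ> C) x = A x"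
      using K(1) by simp
  qed
  ultimately show thesis
    using that comm by blast
qed

text \<open>Let \<open>C\<close> be the root with the commutation property and \<open>D\<close> another root. Then \<open>D\<close> commutes
  with \<open>A = D \<circ> D\<close>, hence with \<open>C\<close>, and \<open>(C + D) (C - D) = 0\<close>. As \<open>C\<close> and \<open>D\<close> are both positive,
  both vanish on the range of \<open>C - D\<close>, so \<open>(C - D)\<^sup>2 = 0\<close>.\<close>

lemma positive_root_ex1:
  assumes A: "positive_op A"
  shows "\<exists>!C. positive_op C \<and> C \<circ> C = A"
proof -
  obtain C where C: "positive_op C" "C \<circ> C = A"
    and comm: "\<And>D x. bounded_linear D \<Longrightarrow> (\<And>x. D (A x) = A (D x)) \<Longrightarrow> D (C x) = C (D x)"
    using positive_root_exists[OF A] by blast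
  show ?thesis
  proof (rule ex1I[of _ C])
    show "positive_op C \<and> C \<circ> C = A"
      using C by simp
    fix D
    assume D: "positive_op D \<and> D \<circ> D = A"
    note linC = bounded_clinearD[OF positive_op_bounded_clinear[OF C(1)]]
    note linD = bounded_clinearD[OF positive_op_bounded_clinear[OF conjunct1[OF D]]]
    have CC: "C (C x) = A x" and DD: "D (D x) = A x" for x
      using C(2) D by (auto simp: fun_eq_iff)
    have DC: "D (C x) = C (D x)" for x
    proof (rule comm[OF linD(1)])
      show "D (A x) = A (D x)" for x
        using DD by metis
    qed
    show "D = C"
    proof
      fix x
      define y where "y = C x - D x"
      have "C y + D y = 0"
        by (simp add: y_def linC linD CC DD DC)
      then have "cinner (C y) y + cinner (D y) y = 0"
        by (metis cinner_add_left cinner_zero_left)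
      then have "Re (cinner (C y) y) + Re (cinner (D y) y) = 0"
        by (metis plus_complex.simps(1) zero_complex.simps(1))
      moreover have "0 \<le> Re (cinner (C y) y)" "0 \<le> Re (cinner (D y) y)"
        using positive_op_real(2) C(1) D by blast+
      ultimately have "C y = 0" "D y = 0"
        using positive_op_eq_0 C(1) D by (metis add_nonneg_eq_0_iff)+
      moreover have "cinner y y = cinner x (C y - D y)"
        using positive_op_symmetric[OF C(1)] positive_op_symmetric[OF conjunct1[OF D]]
        by (subst y_def) (simp add: cinner_simps)
      ultimately have "y = 0"
        by (simp add: cinner_self)
      then show "D x = C x"
        by (simp add: y_def)
    qed
  qed
qed

lemma sqrt_op:
  assumes "positive_op A"
  shows positive_sqrt_op: "positive_op (sqrt_op A)"
    and sqrt_op_sqrt_op: "sqrt_op A (sqrt_op A x) = A x"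
proof -
  have "positive_op (sqrt_op A) \<and> sqrt_op A \<circ> sqrt_op A = A"
    unfolding sqrt_op_def by (rule theI'[OF positive_root_ex1[OF assms]])
  then show "positive_op (sqrt_op A)" "sqrt_op A (sqrt_op A x) = A x"
    by (auto dest: fun_cong)
qed

lemma A_inner_sqrt:
  assumes "positive_op A"
  shows "A_inner A x y = cinner (sqrt_op A x) (sqrt_op A y)"
  using positive_op_symmetric[OF positive_sqrt_op[OF assms], of "sqrt_op A x" y]
  by (simp add: A_inner_def sqrt_op_sqrt_op[OF assms])

lemma A_norm_sqrt:
  assumes "positive_op A"
  shows "A_norm A x = norm (sqrt_op A x)"
  by (simp add: A_norm_def A_inner_sqrt[OF assms] Re_cinner_self)

section \<open>Rank one operators\<close>

lemma cadjointI:
  assumes "\<And>x y. cinner (T x) y = cinner x (S y)"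
  shows "cadjoint T = S"
  unfolding cadjoint_def
proof (rule the_equality)
  fix S'
  assume "\<forall>x y. cinner (T x) y = cinner x (S' y)"
  then have "cinner x (S' y) = cinner x (S y)" for x y
    by (metis assms)
  then show "S' = S"
    by (rule ext[OF cinner_eqI])
qed (use assms in blast)

lemma bounded_clinear_rank_one:
  fixes C :: "'a::chilbert_space \<Rightarrow> 'a"
  assumes "bounded_clinear C"
  shows "bounded_clinear (\<lambda>z. cinner (C z) y *\<^sub>C x)"
  unfolding bounded_clinear_def
proof (intro conjI allI)
  note lin = bounded_clinearD[OF assms]
  obtain K where K: "\<And>x. norm (C x) \<le> norm x * K"
    using bounded_linear.bounded[OF lin(1)] by blast
  show "bounded_linear (\<lambda>z. cinner (C z) y *\<^sub>C x)"
  proof (rule bounded_linear_intro)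
    show "norm (cinner (C z) y *\<^sub>C x) \<le> norm z * (K * norm y * norm x)" for z
    proof -
      have "norm (cinner (C z) y *\<^sub>C x) \<le> (norm (C z) * norm y) * norm x"
        unfolding norm_scaleC by (intro mult_right_mono norm_cinner_le) auto
      also have "\<dots> \<le> ((norm z * K) * norm y) * norm x"
        by (intro mult_right_mono K) auto
      finally show ?thesis
        by (simp add: mult.assoc)
    qed
    show "cinner (C (r *\<^sub>R z)) y *\<^sub>C x = r *\<^sub>R cinner (C z) y *\<^sub>C x" for r z
      by (simp add: lin cinner_simps scaleC_scaleC[symmetric] scaleC_of_real)
  qed (simp add: lin cinner_simps scaleC_add_left)
  show "cinner (C (c *\<^sub>C z)) y *\<^sub>C x = c *\<^sub>C cinner (C z) y *\<^sub>C x" for c z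
    by (simp add: lin cinner_simps scaleC_scaleC)
qed

text \<open>The adjoint of \<open>x \<otimes> y\<close> maps \<open>w\<close> to \<open>cinner w x *\<^sub>C A y\<close>. In \<open>A y = C (C y)\<close> one factor \<open>C\<close>,
  the square root of \<open>A\<close>, can be pulled out, which leaves the required bounded operator.\<close>

lemma A_rank_one_sqrt_adjointable:
  assumes A: "positive_op A"
  shows "A_rank_one A x y \<in> sqrt_adjointable A"
proof -
  let ?C = "sqrt_op A"
  let ?R = "\<lambda>w. cinner (?C w) x *\<^sub>C ?C y"
  note C = positive_op_bounded_clinear[OF positive_sqrt_op[OF A]]
  have "cadjoint (A_rank_one A x y) = (\<lambda>w. cinner w x *\<^sub>C A y)"
  proof (rule cadjointI)
    show "cinner (A_rank_one A x y z) w = cinner z (cinner w x *\<^sub>C A y)" for z w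
      by (simp add: A_rank_one_def A_inner_def cinner_simps positive_op_symmetric[OF A]
          cinner_commute[of x w])
  qed
  then have "?C \<circ> ?R = cadjoint (A_rank_one A x y) \<circ> ?C"
    by (simp add: fun_eq_iff bounded_clinearD(2)[OF C] sqrt_op_sqrt_op[OF A])
  moreover have "bounded_clinear ?R"
    by (rule bounded_clinear_rank_one[OF C])
  moreover have "bounded_clinear (A_rank_one A x y)"
    unfolding A_rank_one_def[abs_def] A_inner_def
    by (rule bounded_clinear_rank_one[OF positive_op_bounded_clinear[OF A]])
  ultimately show ?thesis
    unfolding sqrt_adjointable_def by blast
qed

lemma A_rank_one_comp:
  assumes "bounded_clinear T"
  shows "A_rank_one A (T x) y = T \<circ> A_rank_one A x y"
  by (simp add: fun_eq_iff A_rank_one_def bounded_clinearD(2)[OF assms])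

section \<open>Numerical ranges of rank one operators\<close>

definition rank_one_range :: "'a::complex_inner set \<Rightarrow> 'a \<Rightarrow> 'a \<Rightarrow> complex set" where
  "rank_one_range L a b = {cinner z b * cinner a z | z. z \<in> L \<and> norm z = 1}"

lemma A_numerical_range_rank_one:
  assumes A: "positive_op A"
  shows "A_numerical_range A (A_rank_one A u v)
    = rank_one_range (range (sqrt_op A)) (sqrt_op A u) (sqrt_op A v)"
proof -
  have "A_inner A (A_rank_one A u v z) z
      = cinner (sqrt_op A z) (sqrt_op A v) * cinner (sqrt_op A u) (sqrt_op A z)" for z
    using bounded_clinearD(2)[OF positive_op_bounded_clinear[OF positive_sqrt_op[OF A]]]
    by (simp add: A_rank_one_def A_inner_sqrt[OF A] cinner_simps)
  then show ?thesis
    by (auto simp: A_numerical_range_def rank_one_range_def A_norm_sqrt[OF A])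
qed

text \<open>Put \<open>p = \<parallel>b\<parallel>\<^sup>2\<close> and \<open>q = \<langle>a, b\<rangle>\<close>. The right-hand range lies in \<open>[0, p]\<close> and contains \<open>p\<close>.
  The vector \<open>b\<close>, normalized, shows that \<open>q\<close> is in the left-hand range, so \<open>0 \<le> q \<le> p\<close>. Let \<open>w\<close>
  be the component of \<open>a\<close> orthogonal to \<open>b\<close>. At \<open>z = b + i w\<close> the form takes the value
  \<open>p (q - i \<parallel>w\<parallel>\<^sup>2)\<close>, whose reality forces \<open>w = 0\<close>. Hence \<open>a = (q / p) b\<close>, the left-hand range lies
  in \<open>[0, q]\<close>, and \<open>p \<le> q\<close>.\<close>

lemma eq_if_rank_one_ranges_eq:
  fixes a b :: "'a::complex_inner"
  assumes L_add: "\<And>x y. x \<in> L \<Longrightarrow> y \<in> L \<Longrightarrow> x + y \<in> L"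
    and L_scale: "\<And>c x. x \<in> L \<Longrightarrow> c *\<^sub>C x \<in> L"
    and a: "a \<in> L" and b: "b \<in> L" "b \<noteq> 0"
    and eq: "rank_one_range L a b = rank_one_range L b b"
  shows "a = b"
proof -
  define p q where "p = (norm b)\<^sup>2" and "q = cinner a b"
  have p: "p > 0" "cinner b b = of_real p"
    using b by (simp_all add: p_def cinner_self)
  have square: "cinner z b * cinner b z = of_real ((cmod (cinner z b))\<^sup>2)" for z
    by (metis cinner_commute complex_norm_square)
  have bound: "(cmod (cinner z b))\<^sup>2 \<le> p" if "norm z = 1" for z
    using norm_cinner_le[of z b] that unfolding p_def by (intro power_mono) auto
  \<comment> \<open>the value at a vector that need not be normalized\<close>
  have scaled: "cinner z b * cinner c z / of_real ((norm z)\<^sup>2) \<in> rank_one_range L c b"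
    if "z \<in> L" "z \<noteq> 0" for z c
  proof -
    define z' where "z' = of_real (1 / norm z) *\<^sub>C z"
    have "z' \<in> L" "norm z' = 1"
      using that by (auto simp: z'_def L_scale norm_scaleC simp del: of_real_divide)
    moreover have "cinner z b * cinner c z / of_real ((norm z)\<^sup>2) = cinner z' b * cinner c z'"
      using that by (simp add: z'_def cinner_simps power2_eq_square)
    ultimately show ?thesis
      unfolding rank_one_range_def by blast
  qed
  have "q \<in> rank_one_range L a b"
    using scaled[OF b, of a] p(1) by (simp only: p(2) p_def[symmetric] q_def) simp
  then have "q \<in> rank_one_range L b b"
    by (simp only: eq)
  then obtain z where "norm z = 1" "q = cinner z b * cinner b z"
    unfolding rank_one_range_def by blast
  then have "q = of_real ((cmod (cinner z b))\<^sup>2)" "(cmod (cinner z b))\<^sup>2 \<le> p"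
    using bound by (simp_all only: square)
  then obtain r where r: "q = of_real r" "0 \<le> r" "r \<le> p"
    using that zero_le_power2 by blast
  define w where "w = a - (r / p) *\<^sub>R b"
  have wb: "cinner w b = 0"
    using p r by (simp add: w_def cinner_simps q_def[symmetric])
  then have bw: "cinner b w = 0"
    by (subst cinner_commute) simp
  have a_split: "a = w + (r / p) *\<^sub>R b"
    by (simp add: w_def)
  then have aw: "cinner a w = of_real ((norm w)\<^sup>2)"
    by (metis cinner_add_left cinner_scaleR_left cinner_self bw mult_zero_right add_0_right)
  have "w \<in> L"
  proof -
    have "w = a + of_real (- r / p) *\<^sub>C b"
      by (simp only: w_def scaleC_of_real) simp
    then show ?thesis
      by (simp only: L_add L_scale a b)
  qed
  have "w = 0"
  proof -
    define z where "z = b + \<i> *\<^sub>C w"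
    have zb: "cinner z b = of_real p"
      by (simp add: z_def cinner_simps wb p)
    then have "z \<noteq> 0"
      using p by auto
    moreover have "z \<in> L"
      unfolding z_def by (intro L_add L_scale \<open>w \<in> L\<close> b)
    ultimately have "of_real p * cinner a z / of_real ((norm z)\<^sup>2) \<in> rank_one_range L b b"
      using scaled[of z a] zb eq by simp
    then have "Im (of_real p * cinner a z / of_real ((norm z)\<^sup>2)) = 0"
      unfolding rank_one_range_def square by force
    then have "Im (cinner a z) = 0"
      using p \<open>z \<noteq> 0\<close> by (simp add: Im_divide_of_real del: of_real_power)
    then have "(norm w)\<^sup>2 = 0"
      using r by (simp add: z_def cinner_simps aw q_def[symmetric] del: of_real_power)
    then show ?thesis
      by simp
  qed
  with a_split have a_eq: "a = (r / p) *\<^sub>R b"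
    by simp
  have "of_real p \<in> rank_one_range L b b"
    using scaled[OF b, of b] p(1) by (simp only: p(2) p_def[symmetric]) simp
  then have "of_real p \<in> rank_one_range L a b"
    by (simp add: eq)
  then obtain z where z: "norm z = 1" "of_real p = cinner z b * cinner a z"
    unfolding rank_one_range_def by blast
  have "cinner z b * cinner a z = of_real (r / p * (cmod (cinner z b))\<^sup>2)"
    using square[of z] by (simp add: a_eq cinner_simps mult.left_commute)
  with z have "p = r / p * (cmod (cinner z b))\<^sup>2"
    using of_real_eq_iff by metis
  also have "\<dots> \<le> r / p * p"
    using bound[OF z(1)] p r by (intro mult_left_mono) auto
  finally have "p = r"
    using p r by simp
  then show ?thesis
    using a_eq p by simp
qed

section \<open>Equality of operators and of numerical ranges\<close>

theorem corollary2p8: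
  fixes A T S :: "'a::chilbert_space \<Rightarrow> 'a"
  assumes "positive_op A"
    and "T \<in> sqrt_adjointable A"
    and "S \<in> sqrt_adjointable A"
  shows "(sqrt_op A \<circ> T = sqrt_op A \<circ> S \<longleftrightarrow>
          (\<forall>R \<in> sqrt_adjointable A. A_numerical_range A (T \<circ> R) = A_numerical_range A (S \<circ> R)))
       \<and> ((\<forall>R \<in> sqrt_adjointable A. A_numerical_range A (T \<circ> R) = A_numerical_range A (S \<circ> R)) \<longleftrightarrow>
          (\<forall>x y. x \<noteq> 0 \<longrightarrow> y \<noteq> 0 \<longrightarrow>
             A_numerical_range A (A_rank_one A (T x) y) = A_numerical_range A (A_rank_one A (S x) y)))"
    (is "(?i \<longleftrightarrow> ?ii) \<and> (_ \<longleftrightarrow> ?iii)")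
proof -
  let ?C = "sqrt_op A"
  note A = assms(1)
  note linC = bounded_clinearD[OF positive_op_bounded_clinear[OF positive_sqrt_op[OF A]]]
  have T: "bounded_clinear T" and S: "bounded_clinear S"
    using assms(2,3) by (auto simp: sqrt_adjointable_def)
  have i_ii: "?ii" if "?i"
  proof -
    have "?C (T x) = ?C (S x)" for x
      using that by (simp add: fun_eq_iff)
    then show ?thesis
      by (simp add: A_numerical_range_def A_inner_sqrt[OF A])
  qed
  have ii_iii: "?iii" if "?ii"
    using that A_rank_one_sqrt_adjointable[OF A] by (simp add: A_rank_one_comp T S)
  have iii_i: "?i" if iii: "?iii"
  proof
    have L_add: "x + y \<in> range ?C" if "x \<in> range ?C" "y \<in> range ?C" for x y
      using that by (auto simp: linC(3)[symmetric])
    have L_scale: "c *\<^sub>C x \<in> range ?C" if "x \<in> range ?C" for c x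
      using that by (auto simp: linC(2)[symmetric])
    fix x
    have ranges: "rank_one_range (range ?C) (?C (T x)) (?C y)
        = rank_one_range (range ?C) (?C (S x)) (?C y)" if "?C y \<noteq> 0" for y
    proof (cases "x = 0")
      case True
      then show ?thesis
        by (simp add: bounded_clinearD(6)[OF T] bounded_clinearD(6)[OF S])
    next
      case False
      moreover have "y \<noteq> 0"
        using that linC(6) by auto
      ultimately show ?thesis
        using iii by (simp add: A_numerical_range_rank_one[OF A])
    qed
    \<comment> \<open>\<open>y = S x\<close> settles the case \<open>C (S x) \<noteq> 0\<close>; otherwise \<open>y = T x\<close> settles \<open>C (T x) \<noteq> 0\<close>\<close>
    have "?C (T x) = ?C (S x)"
    proof (cases "?C (S x) = 0")
      case False
      from ranges[OF False] show ?thesis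
        by (intro eq_if_rank_one_ranges_eq[OF L_add L_scale _ _ False]) auto
    next
      case zero: True
      show ?thesis
      proof (cases "?C (T x) = 0")
        case False
        from ranges[OF False] show ?thesis
          by (intro eq_if_rank_one_ranges_eq[OF L_add L_scale _ _ False, symmetric]) auto
      qed (simp add: zero)
    qed
    then show "(?C \<circ> T) x = (?C \<circ> S) x"
      by simp
  qed
  show ?thesis
    by (intro conjI iffI)
      (rule i_ii iii_i[OF ii_iii] ii_iii i_ii[OF iii_i], assumption)+
qed

end
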